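(* Let $k$ be a positive integer, $q\ge k$ a prime, $d$ an integer with $0<d<k$, $n=kq$, $\mu\in[1/2,1)$, and let $r$ be the smallest integer strictly greater than $\mu k$. Let $\mathcal{A}_{poly}$ be the polynomial design with parameters $(k,q,d)$. Let $\gamma\in(0,1)$ with $\gamma n\in\mathbb{N}$. Then the efficiency factor $\eta$ of the custody scheme $(S,\mathcal{A}_{poly},\mu)$ against a $\gamma$-adversary satisfies $$\eta \;\ge\; \gamma^{1-d}\cdot \binom{r}{d}\Big/\binom{k}{d} \;-\; 1 .$$
   Context: A custody scheme $(S,\mathcal{A},\mu)$ consists of a set $S$ of $n$ nodes, a family $\mathcal{A}$ of $m$ $k$-subsets of $S$ (called groups), and a threshold $\mu\in[1/2,1)$. For $\gamma\in(0,1)$ with $\gamma n\in\mathbb{N}$ let $$f(\gamma;S,\mathcal{A},\mu):=\max_{B\subseteq S,\ |B|=\gamma n}\big|\{A\in\mathcal{A} : |A\cap B|>\mu k\}\big|$$ (the maximal number of groups corrupted when $\gamma n$ nodes are corrupted; with $r$ the smallest integer greater than $\mu k$, a group is corrupted iff it contains at least $r$ corrupted nodes). The efficiency factor against a $\gamma$-adversary is $\eta:=\dfrac{\gamma m}{f(\gamma;S,\mathcal{A},\mu)}-1$, with $\eta=+\infty$ if $f=0$. Polynomial design: $S$ is identified with $T=\{(a,b): 0\le a\le k-1,\ 0\le b\le q-1\}$, so $n=kq$. For a polynomial $p$ over $\mathbb{Z}/q\mathbb{Z}$ put $A(p)=\{(i,p(i)) : 0\le i\le k-1\}$ (values taken in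 $\{0,\dots,q-1\}$). Then $\mathcal{A}_{poly}=\{A(p) : p \text{ a monic polynomial of degree } d \text{ over } \mathbb{Z}/q\mathbb{Z}\}$, which has $m=q^d$ groups. *)

theory Defs
  imports
    "HOL-Number_Theory.Residues"
    "HOL-Algebra.Polynomial_Divisibility"
    "HOL-Library.Extended_Real"
begin

definition custody_scheme :: "'a set \<Rightarrow> 'a set set \<Rightarrow> nat \<Rightarrow> real \<Rightarrow> bool" where
  "custody_scheme S \<A> k \<mu> \<longleftrightarrow>
     finite S \<and> (\<forall>A\<in>\<A>. A \<subseteq> S \<and> card A = k) \<and> 1/2 \<le> \<mu> \<and> \<mu> < 1"

definition corrupted_groups :: "'a set set \<Rightarrow> nat \<Rightarrow> real \<Rightarrow> 'a set \<Rightarrow> 'a set set" where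
  "corrupted_groups \<A> k \<mu> B = {A \<in> \<A>. real (card (A \<inter> B)) > \<mu> * real k}"

(* Only meaningful if S is finite, 0 <= \<gamma> <= 1 and \<gamma> * card S is a natural number;
   otherwise Max may range over the empty set. *)
definition max_corrupted :: "real \<Rightarrow> 'a set \<Rightarrow> 'a set set \<Rightarrow> nat \<Rightarrow> real \<Rightarrow> nat" where
  "max_corrupted \<gamma> S \<A> k \<mu> =
     Max {card (corrupted_groups \<A> k \<mu> B) | B. B \<subseteq> S \<and> real (card B) = \<gamma> * real (card S)}"

definition efficiency :: "real \<Rightarrow> 'a set \<Rightarrow> 'a set set \<Rightarrow> nat \<Rightarrow> real \<Rightarrow> ereal" where
  "efficiency \<gamma> S \<A> k \<mu> =
     (if max_corrupted \<gamma> S \<A> k \<mu> = 0 then \<infinity>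
      else ereal (\<gamma> * real (card \<A>) / real (max_corrupted \<gamma> S \<A> k \<mu>) - 1))"

definition poly_nodes :: "nat \<Rightarrow> nat \<Rightarrow> (int \<times> int) set" where
  "poly_nodes k q = {0..int k - 1} \<times> {0..int q - 1}"

(* Elements of the carrier of poly_ring R are coefficient lists, leading coefficient first; the
   zero polynomial is the empty list and is excluded explicitly, as its Polynomials.degree is 0
   and its Polynomials.lead_coeff is unspecified. *)
definition monic_polys :: "nat \<Rightarrow> nat \<Rightarrow> int list set" where
  "monic_polys q d =
     {p \<in> carrier (poly_ring (residue_ring (int q))).
        p \<noteq> [] \<and> Polynomials.degree p = d \<and>
        Polynomials.lead_coeff p = \<one>\<^bsub>residue_ring (int q)\<^esub>}"

(* The index i is used as an element of residue_ring q, whose carrier is {0..q-1};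
   this relies on k <= q. *)
definition poly_group :: "nat \<Rightarrow> nat \<Rightarrow> int list \<Rightarrow> (int \<times> int) set" where
  "poly_group k q p = (\<lambda>i. (i, ring.eval (residue_ring (int q)) p i)) ` {0..int k - 1}"

definition poly_design :: "nat \<Rightarrow> nat \<Rightarrow> nat \<Rightarrow> (int \<times> int) set set" where
  "poly_design k q d = poly_group k q ` monic_polys q d"

lemma card_poly_nodes: "card (poly_nodes k q) = k * q"
  by (simp add: poly_nodes_def card_cartesian_product)

lemma custody_scheme_poly_design:
  assumes "Factorial_Ring.prime q" "k \<le> q" "1/2 \<le> \<mu>" "\<mu> < 1"
  shows "custody_scheme (poly_nodes k q) (poly_design k q d) k \<mu>"
proof -
  interpret residues_prime q "residue_ring (int q)"
    using assms(1) by (simp_all add: residues_prime_def)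
  have "poly_group k q p \<subseteq> poly_nodes k q \<and> card (poly_group k q p) = k"
    if "p \<in> monic_polys q d" for p
  proof
    have p: "set p \<subseteq> carrier (residue_ring (int q))"
      using that polynomial_incl unfolding monic_polys_def univ_poly_carrier[symmetric] by blast
    have "ring.eval (residue_ring (int q)) p i \<in> {0..int q - 1}" if "i \<in> {0..int k - 1}" for i
      using eval_in_carrier[OF p, of i] that assms(2) by (simp add: res_carrier_eq)
    then show "poly_group k q p \<subseteq> poly_nodes k q"
      by (auto simp: poly_group_def poly_nodes_def)
    show "card (poly_group k q p) = k"
      unfolding poly_group_def by (subst card_image) (auto simp: inj_on_def)
  qed
  then show ?thesis
    using assms by (auto simp: custody_scheme_def poly_design_def poly_nodes_def)
qed

end

theory Submission
  imports Defs
begin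

text \<open>
  Write \<open>b i\<close> for the number of corrupted nodes in column \<open>i\<close> of the grid. A monic polynomial of degree
  \<open>d\<close> is determined by its values at any \<open>d\<close> points, so at most \<open>\<Prod>i\<in>I. b i\<close> groups meet the corrupted
  set in all columns of a \<open>d\<close>-set \<open>I\<close>. Each corrupted group does so for at least \<open>r choose d\<close> sets
  \<open>I\<close>; hence the number of corrupted groups times \<open>r choose d\<close> is at most the \<open>d\<close>-th elementary
  symmetric polynomial of the \<open>b i\<close>. By Maclaurin's inequality the latter is at most
  \<open>(k choose d) * (\<gamma> * q) ^ d\<close>, since the \<open>b i\<close> have mean \<open>\<gamma> * q\<close>.
\<close>

section \<open>Elementary symmetric polynomials and Maclaurin's inequality\<close>

lemma add_power_ge_tangent:
  fixes t h :: real
  assumes "0 \<le> t" "0 \<le> t + h"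
  shows "t ^ Suc d + real (Suc d) * t ^ d * h \<le> (t + h) ^ Suc d"
proof (induction d)
  case 0
  then show ?case by simp
next
  case (Suc d)
  \<comment> \<open>Multiplying the induction hypothesis by \<open>t + h\<close> leaves a surplus
    term in \<open>h\<^sup>2\<close>, which is nonnegative and dropped at the end.\<close>
  have "t ^ Suc (Suc d) + real (Suc (Suc d)) * t ^ Suc d * h + real (Suc d) * t ^ d * h\<^sup>2
      = (t ^ Suc d + real (Suc d) * t ^ d * h) * (t + h)"
    by (simp add: algebra_simps power2_eq_square)
  also have "\<dots> \<le> (t + h) ^ Suc d * (t + h)"
    using Suc assms(2) by (rule mult_right_mono)
  also have "\<dots> = (t + h) ^ Suc (Suc d)"
    by simp
  finally show ?case
    using assms(1) by (smt (verit) mult_nonneg_nonneg of_nat_0_le_iff zero_le_power zero_le_power2)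
qed

text \<open>The elementary symmetric polynomial of degree \<open>d\<close>, over a semiring so that
  it serves both for counts in \<open>nat\<close> and for the real inequality.\<close>

definition esymm :: "nat \<Rightarrow> 'a set \<Rightarrow> ('a \<Rightarrow> 'b::comm_semiring_1) \<Rightarrow> 'b" where
  "esymm d K x = (\<Sum>I | I \<subseteq> K \<and> card I = d. \<Prod>i\<in>I. x i)"

lemma esymm_0: "finite K \<Longrightarrow> esymm 0 K x = 1"
proof -
  assume "finite K"
  then have "{I. I \<subseteq> K \<and> card I = 0} = {{}}"
    by (auto dest: finite_subset)
  then show ?thesis
    by (simp add: esymm_def)
qed

lemma esymm_empty_Suc: "esymm (Suc d) {} x = 0"
  unfolding esymm_def by (rule sum.neutral) auto

text \<open>Index sets are split by whether they contain \<open>a\<close>; removing \<open>a\<close>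
  from those that do leaves the \<open>d\<close>-subsets of \<open>K\<close>.\<close>

lemma esymm_insert_Suc:
  assumes "finite K" "a \<notin> K"
  shows "esymm (Suc d) (insert a K) x = esymm (Suc d) K x + x a * esymm d K x"
proof -
  let ?S = "\<lambda>d. {I. I \<subseteq> K \<and> card I = d}"
  have fin: "finite I" if "I \<subseteq> K" for I
    using that assms(1) by (rule finite_subset)
  have split: "{I. I \<subseteq> insert a K \<and> card I = Suc d} = ?S (Suc d) \<union> insert a ` ?S d"
  proof (intro equalityI subsetI)
    fix I assume I: "I \<in> {I. I \<subseteq> insert a K \<and> card I = Suc d}"
    show "I \<in> ?S (Suc d) \<union> insert a ` ?S d"
    proof (cases "a \<in> I")
      case True
      then have "I = insert a (I - {a})" "I - {a} \<in> ?S d"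
        using I by auto
      then show ?thesis by blast
    qed (use I in auto)
  qed (use assms fin in \<open>auto simp: card_insert_if subset_iff\<close>)
  have inj: "inj_on (insert a) (?S d)"
    using assms(2) by (intro inj_onI) (metis (no_types, lifting) insert_ident mem_Collect_eq subsetD)
  have "esymm (Suc d) (insert a K) x = esymm (Suc d) K x + (\<Sum>I\<in>insert a ` ?S d. \<Prod>i\<in>I. x i)"
    unfolding esymm_def split using assms
    by (intro sum.union_disjoint) auto
  also have "(\<Sum>I\<in>insert a ` ?S d. \<Prod>i\<in>I. x i) = (\<Sum>I\<in>?S d. x a * (\<Prod>i\<in>I. x i))"
    unfolding sum.reindex[OF inj] o_def
    using assms(2) fin by (intro sum.cong refl prod.insert) auto
  finally show ?thesis
    by (simp add: esymm_def sum_distrib_left)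
qed

text \<open>
  The induction step adds one number to \<open>k\<close> numbers of mean \<open>t\<close>; if this changes the mean to \<open>t + h\<close>,
  the claim reduces to Bernoulli's inequality in the homogeneous form of \<open>add_power_ge_tangent\<close>, which also covers \<open>t = 0\<close>.
\<close>

lemma maclaurin_esymm_le:
  fixes x :: "'a \<Rightarrow> real"
  assumes "finite K" "\<And>i. i \<in> K \<Longrightarrow> 0 \<le> x i"
  shows "esymm d K x \<le> real (card K choose d) * (sum x K / real (card K)) ^ d"
  using assms
proof (induction K arbitrary: d rule: finite_induct)
  case empty
  show ?case
    by (cases d) (simp_all add: esymm_0 esymm_empty_Suc)
next
  case (insert a K)
  show ?case
  proof (cases d)
    case 0
    then show ?thesis
      using insert.hyps by (simp add: esymm_0)
  next
    case (Suc e)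
    define k where "k = card K"
    define t where "t = sum x K / real k"
    define h where "h = (x a - t) / real (Suc k)"
    \<comment> \<open>For \<open>k = 0\<close> the division yields \<open>t = 0\<close>, and the
      equation still holds because the sum is empty.\<close>
    have kt: "real k * t = sum x K"
      using insert.hyps by (cases "k = 0") (auto simp: t_def k_def)
    have nonneg: "0 \<le> x a" "0 \<le> t"
      using insert.prems by (auto simp: t_def intro!: divide_nonneg_nonneg sum_nonneg)
    have xa: "x a = t + real (Suc k) * h"
      by (simp add: h_def)
    have mean: "t + h = sum x (insert a K) / real (card (insert a K))"
      using insert.hyps kt by (simp add: h_def k_def[symmetric] field_simps)
    have th: "0 \<le> t + h"
      unfolding mean using insert.prems by (intro divide_nonneg_nonneg sum_nonneg) auto
    have binom: "real (Suc k) * real (k choose e) = real (Suc k choose Suc e) * real (Suc e)"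
      using Suc_times_binomial_eq[of k e] by (metis of_nat_mult)
    have "esymm d (insert a K) x = esymm (Suc e) K x + x a * esymm e K x"
      using Suc esymm_insert_Suc[OF insert.hyps] by simp
    also have "\<dots> \<le> real (k choose Suc e) * t ^ Suc e + x a * (real (k choose e) * t ^ e)"
      using insert.IH[of "Suc e"] insert.IH[of e] insert.prems nonneg
      unfolding t_def k_def by (intro add_mono mult_left_mono) auto
    \<comment> \<open>Substituting \<open>xa\<close> and merging the two \<open>t ^ Suc e\<close>
      terms by Pascal's rule; the absorption identity \<open>binom\<close> then turns the rest into
      the slope of the tangent.\<close>
    also have "\<dots> = real (Suc k choose Suc e) * t ^ Suc e + (real (Suc k) * real (k choose e)) * t ^ e * h"
      by (simp add: xa algebra_simps)
    also have "\<dots> = real (Suc k choose Suc e) * (t ^ Suc e + real (Suc e) * t ^ e * h)"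
      unfolding binom by (simp only: algebra_simps)
    also have "\<dots> \<le> real (Suc k choose Suc e) * (t + h) ^ Suc e"
      using add_power_ge_tangent[OF nonneg(2) th] by (rule mult_left_mono) simp
    finally show ?thesis
      using insert.hyps mean Suc by (simp add: k_def)
  qed
qed

section \<open>Double counting\<close>

text \<open>Counts the pairs \<open>(p, I)\<close> where \<open>I\<close> is a
  \<open>d\<close>-subset of \<open>K\<close> on which \<open>g p\<close> stays in \<open>B\<close>.
  Each \<open>p\<close> has at least \<open>r choose d\<close> such \<open>I\<close>; for fixed
  \<open>I\<close>, restriction embeds the \<open>p\<close> into the product of the
  \<open>B i\<close>.\<close>

lemma card_mult_choose_le_esymm:
  fixes g :: "'p \<Rightarrow> 'i \<Rightarrow> 'v" and B :: "'i \<Rightarrow> 'v set"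
  assumes "finite K" "finite P" "\<And>i. i \<in> K \<Longrightarrow> finite (B i)"
    and inj: "\<And>I. I \<subseteq> K \<Longrightarrow> card I = d \<Longrightarrow> inj_on (\<lambda>p. restrict (g p) I) P"
    and r: "\<And>p. p \<in> P \<Longrightarrow> r \<le> card {i \<in> K. g p i \<in> B i}"
  shows "card P * (r choose d) \<le> esymm d K (\<lambda>i. card (B i))"
proof -
  let ?S = "{I. I \<subseteq> K \<and> card I = d}"
  let ?R = "\<lambda>p I. \<forall>i\<in>I. g p i \<in> B i"
  have finS: "finite ?S"
    using assms(1) by simp
  have "card P * (r choose d) = (\<Sum>p\<in>P. r choose d)"
    by simp
  also have "\<dots> \<le> (\<Sum>p\<in>P. card {I \<in> ?S. ?R p I})"
  proof (rule sum_mono)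
    fix p assume "p \<in> P"
    then have "r choose d \<le> card {i \<in> K. g p i \<in> B i} choose d"
      by (intro binomial_right_mono r)
    also have "\<dots> = card {I. I \<subseteq> {i \<in> K. g p i \<in> B i} \<and> card I = d}"
      using assms(1) by (subst n_subsets) auto
    also have "{I. I \<subseteq> {i \<in> K. g p i \<in> B i} \<and> card I = d} = {I \<in> ?S. ?R p I}"
      by auto
    finally show "r choose d \<le> card {I \<in> ?S. ?R p I}" .
  qed
  also have "\<dots> = (\<Sum>I\<in>?S. card {p \<in> P. ?R p I})"
    by (rule sum_multicount_gen[symmetric]) (use finS assms(2) in auto)
  also have "\<dots> \<le> (\<Sum>I\<in>?S. \<Prod>i\<in>I. card (B i))"
  proof (rule sum_mono)
    fix I assume "I \<in> ?S"
    then have I: "I \<subseteq> K" "card I = d" "finite I"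
      using assms(1) by (auto dest: finite_subset)
    have "card {p \<in> P. ?R p I} \<le> card (PiE I B)"
    proof (rule card_inj_on_le)
      show "inj_on (\<lambda>p. restrict (g p) I) {p \<in> P. ?R p I}"
        by (rule inj_on_subset[OF inj[OF I(1,2)]]) auto
      show "finite (PiE I B)"
        using I assms(3) by (intro finite_PiE) auto
    qed auto
    also have "\<dots> = (\<Prod>i\<in>I. card (B i))"
      using I(3) by (rule card_PiE)
    finally show "card {p \<in> P. ?R p I} \<le> (\<Prod>i\<in>I. card (B i))" .
  qed
  finally show ?thesis
    by (simp add: esymm_def)
qed


section \<open>Uniqueness of polynomial interpolation\<close>

lemma (in ring) eval_Cons_cancel:
  assumes "c \<in> carrier R" "set a \<subseteq> carrier R" "set b \<subseteq> carrier R" "x \<in> carrier R"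
    and "length a = length b" "eval (c # a) x = eval (c # b) x"
  shows "eval a x = eval b x"
proof -
  define y where "y = c \<otimes> x [^] length b"
  have y: "y \<in> carrier R"
    using assms by (simp add: y_def)
  have "y \<oplus> eval a x = y \<oplus> eval b x"
    using assms(5,6) by (simp add: y_def)
  then show ?thesis
    using r_neg1[OF y eval_in_carrier[OF assms(2,4)]] r_neg1[OF y eval_in_carrier[OF assms(3,4)]]
    by metis
qed

text \<open>Otherwise the difference would be a nonzero polynomial of degree below
  \<open>length a\<close> with all of \<open>D\<close> among its roots, too many over a
  field.\<close>

lemma (in field) eval_inj_lists:
  assumes "set a \<subseteq> carrier R" "set b \<subseteq> carrier R" "length a = length b"
    and D: "D \<subseteq> carrier R" "finite D" "length a \<le> card D"
    and eq: "\<And>x. x \<in> D \<Longrightarrow> eval a x = eval b x"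
  shows "a = b"
proof -
  have diff: "set (map2 (a_minus R) a b) \<subseteq> carrier R"
    "\<And>x. x \<in> carrier R \<Longrightarrow> eval (map2 (a_minus R) a b) x = eval a x \<ominus> eval b x"
    "set (map2 (a_minus R) a b) \<subseteq> {\<zero>} \<Longrightarrow> a = b"
    using assms(3,1,2)
  proof (induction a b rule: list_induct2)
    case (Cons u a v b)
    {
      case 1
      then show ?case using Cons.IH(1) by auto
    next
      case (2 x)
      then have "eval a x \<in> carrier R" "eval b x \<in> carrier R" "x [^] length b \<in> carrier R"
        by (auto intro: eval_in_carrier)
      with 2 show ?case using Cons.IH(2)[of x] Cons.hyps
        by (simp add: minus_eq l_distr l_minus minus_add a_ac)
    next
      case 3
      then show ?case using Cons.IH(3) by (auto simp: r_right_minus_eq)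
    }
  qed (auto simp: minus_eq)
  \<comment> \<open>The coefficientwise difference may start with zeros; stripping them yields an
    element of the polynomial ring, to which the root bound applies.\<close>
  define h where "h = normalize (map2 (a_minus R) a b)"
  have h: "h \<in> carrier (poly_ring R)"
    using normalize_gives_polynomial[OF diff(1)] by (simp add: h_def univ_poly_carrier)
  have "h = []"
  proof (rule ccontr)
    assume "h \<noteq> []"
    have "is_root h x" if "x \<in> D" for x
    proof -
      have "x \<in> carrier R" using that D(1) by blast
      then show ?thesis
        using \<open>h \<noteq> []\<close> that diff(2)[of x] eval_normalize[OF diff(1), of x] eq[of x]
          eval_in_carrier[OF assms(2), of x]
        by (simp add: is_root_def h_def minus_eq r_neg)
    qed
    then have "D \<subseteq> set_mset (roots h)"
      using roots_mem_iff_is_root[OF h] by blast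
    then have "card D \<le> card (set_mset (roots h))"
      by (rule card_mono[rotated]) simp
    also have "\<dots> \<le> size (roots h)"
      unfolding size_multiset_overloaded_eq card_eq_sum by (intro sum_mono) (simp add: Suc_le_eq)
    also have "\<dots> \<le> length h - 1"
      using size_roots_le_degree[OF h] .
    \<comment> \<open>Strict because \<open>h\<close> is nonempty, so that
      \<open>length h - 1\<close> is not truncated.\<close>
    also have "\<dots> < length a"
      using \<open>h \<noteq> []\<close> normalize_length_le[of "map2 (a_minus R) a b"] assms(3)
      by (cases h) (auto simp: h_def[symmetric])
    finally show False using D(3) by simp
  qed
  then have "map2 (a_minus R) a b = replicate (length a) \<zero>"
    using normalize_trick[of "map2 (a_minus R) a b"] assms(3) by (simp add: h_def)
  then show "a = b"
    by (intro diff(3)) auto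
qed

section \<open>The polynomial design over a prime field\<close>

context
  fixes q :: nat
  assumes prime_q: "Factorial_Ring.prime q"
begin

interpretation residues_prime q "residue_ring (int q)"
  using prime_q by (simp_all add: residues_prime_def)

interpretation field "residue_ring (int q)"
  by (rule is_field)

lemma monic_polys_eq:
  "monic_polys q d = Cons 1 ` {a. set a \<subseteq> {0..int q - 1} \<and> length a = d}"
proof -
  \<comment> \<open>This puts the leading coefficient 1 into the carrier
    \<open>{0..int q - 1}\<close>.\<close>
  have "1 < q"
    using prime_q by (rule prime_gt_1_nat)
  then have "p \<in> monic_polys q d \<longleftrightarrow> (\<exists>a. p = 1 # a \<and> set a \<subseteq> {0..int q - 1} \<and> length a = d)" for p
    unfolding monic_polys_def univ_poly_carrier[symmetric] polynomial_def
    by (cases p) (auto simp: res_carrier_eq res_one_eq res_zero_eq)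
  then show ?thesis
    by auto
qed

lemma finite_monic_polys: "finite (monic_polys q d)"
  by (simp add: monic_polys_eq finite_lists_length_eq)

lemma card_monic_polys: "card (monic_polys q d) = q ^ d"
  unfolding monic_polys_eq by (subst card_image) (auto simp: card_lists_length_eq)

text \<open>With the leading coefficient fixed only \<open>d\<close> coefficients are unknown, so
  \<open>d\<close> points suffice instead of \<open>d + 1\<close>.\<close>

lemma monic_polys_eq_if_eval_eq:
  assumes "p \<in> monic_polys q d" "p' \<in> monic_polys q d"
    and D: "D \<subseteq> {0..int q - 1}" "d \<le> card D"
    and eq: "\<And>x. x \<in> D \<Longrightarrow> eval p x = eval p' x"
  shows "p = p'"
proof -
  obtain a b where ab: "p = 1 # a" "p' = 1 # b" "length a = d" "length b = d"
    "set a \<subseteq> carrier (residue_ring (int q))" "set b \<subseteq> carrier (residue_ring (int q))"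
    using assms(1,2) by (auto simp: monic_polys_eq res_carrier_eq)
  have D': "D \<subseteq> carrier (residue_ring (int q))" "finite D"
    using D(1) by (auto simp: res_carrier_eq intro: finite_subset)
  have "eval a x = eval b x" if "x \<in> D" for x
  proof -
    have x: "x \<in> carrier (residue_ring (int q))"
      using that D' by blast
    have "1 \<in> carrier (residue_ring (int q))"
      using one_closed by (simp add: res_one_eq)
    then show ?thesis
      using eval_Cons_cancel[of 1 a b x] ab x eq[OF that] by metis
  qed
  then have "a = b"
    using ab D' D(2) by (intro eval_inj_lists[of a b D]) auto
  then show ?thesis
    by (simp add: ab)
qed

text \<open>A group is the graph of its polynomial on \<open>k\<close> points, and
  \<open>d \<le> k\<close> of them already determine the polynomial.\<close>

lemma card_poly_design:
  assumes "k \<le> q" "d \<le> k"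
  shows "card (poly_design k q d) = q ^ d"
proof -
  have "inj_on (poly_group k q) (monic_polys q d)"
  proof (rule inj_onI)
    fix p p' assume p: "p \<in> monic_polys q d" "p' \<in> monic_polys q d"
      and eq: "poly_group k q p = poly_group k q p'"
    have "eval p i = eval p' i" if "i \<in> {0..int k - 1}" for i
    proof -
      have "(i, eval p i) \<in> poly_group k q p'"
        unfolding eq[symmetric] unfolding poly_group_def using that by (rule imageI)
      then show ?thesis
        by (auto simp: poly_group_def)
    qed
    then show "p = p'"
      by (rule monic_polys_eq_if_eval_eq[OF p, where D = "{0..int k - 1}", rotated 2]) (use assms in auto)
  qed
  then show ?thesis
    by (simp add: poly_design_def card_image card_monic_polys)
qed

lemma card_corrupted_le:
  assumes "k \<le> q" and B: "B \<subseteq> poly_nodes k q"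
    and r: "r = (LEAST j. real j > \<mu> * real k)"
  shows "real (card (corrupted_groups (poly_design k q d) k \<mu> B)) * real (r choose d)
    \<le> real (k choose d) * (real (card B) / real k) ^ d"
proof -
  define K where "K = {0..int k - 1}"
  \<comment> \<open>Polynomials are counted in place of groups; as every corrupted group comes from
    some \<open>p\<close> in \<open>P\<close>, this can only increase the count.\<close>
  define P where "P = {p \<in> monic_polys q d. \<mu> * real k < real (card (poly_group k q p \<inter> B))}"
  let ?B = "\<lambda>i. B `` {i}"
  have finP: "finite P"
    by (simp add: P_def finite_monic_polys)
  have finB: "finite B"
    using B by (rule finite_subset) (simp add: poly_nodes_def)
  have finBi: "finite (?B i)" for i
    using finite_imageI[OF finB, of snd] by (rule rev_finite_subset) force
  have "corrupted_groups (poly_design k q d) k \<mu> B \<subseteq> poly_group k q ` P"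
    by (auto simp: corrupted_groups_def poly_design_def P_def)
  then have "card (corrupted_groups (poly_design k q d) k \<mu> B) \<le> card P"
    using finP by (rule surj_card_le[rotated])
  then have "card (corrupted_groups (poly_design k q d) k \<mu> B) * (r choose d) \<le> card P * (r choose d)"
    by (rule mult_right_mono) simp
  also have "\<dots> \<le> esymm d K (\<lambda>i. card (?B i))"
  proof (rule card_mult_choose_le_esymm)
    fix I assume I: "I \<subseteq> K" "card I = d"
    show "inj_on (\<lambda>p. restrict (eval p) I) P"
    proof (rule inj_onI)
      fix p p' assume "p \<in> P" "p' \<in> P" and eq: "restrict (eval p) I = restrict (eval p') I"
      then show "p = p'"
        using I assms(1)
        by (intro monic_polys_eq_if_eval_eq[of p d p' I])
          (auto simp: P_def K_def dest: fun_cong split: if_splits)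
    qed
  next
    fix p assume "p \<in> P"
    then have "\<mu> * real k < real (card (poly_group k q p \<inter> B))"
      by (simp add: P_def)
    then have "r \<le> card (poly_group k q p \<inter> B)"
      unfolding r by (rule Least_le)
    \<comment> \<open>A group has exactly one node in each column, so its corrupted nodes correspond
      to the columns where they lie.\<close>
    also have "poly_group k q p \<inter> B = (\<lambda>i. (i, eval p i)) ` {i \<in> K. eval p i \<in> ?B i}"
      by (auto simp: poly_group_def K_def)
    also have "card \<dots> = card {i \<in> K. eval p i \<in> ?B i}"
      by (rule card_image) (auto simp: inj_on_def)
    finally show "r \<le> card {i \<in> K. eval p i \<in> ?B i}" .
  qed (use finP finBi in \<open>auto simp: K_def\<close>)
  finally have "real (card (corrupted_groups (poly_design k q d) k \<mu> B)) * real (r choose d)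
      \<le> real (esymm d K (\<lambda>i. card (?B i)))"
    by (metis of_nat_le_iff of_nat_mult)
  also have "\<dots> = esymm d K (\<lambda>i. real (card (?B i)))"
    by (simp add: esymm_def)
  also have "\<dots> \<le> real (card K choose d) * ((\<Sum>i\<in>K. real (card (?B i))) / real (card K)) ^ d"
    by (rule maclaurin_esymm_le) (auto simp: K_def)
  also have "(\<Sum>i\<in>K. real (card (?B i))) = real (card (SIGMA i:K. ?B i))"
    using finBi by (subst card_SigmaI) (auto simp: K_def)
  \<comment> \<open>The columns partition \<open>B\<close>, so the column counts sum to
    \<open>card B\<close>.\<close>
  also have "(SIGMA i:K. ?B i) = B"
    using B by (auto simp: K_def poly_nodes_def)
  finally show ?thesis
    by (simp add: K_def)
qed

end

section \<open>From the corruption bound to the efficiency factor\<close>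

theorem theorem1:
  fixes k q d n r :: nat and \<mu> \<gamma> :: real
  assumes "0 < k"
    and "Factorial_Ring.prime q" and "k \<le> q"
    and "0 < d" and "d < k"
    and "n = k * q"
    and "1/2 \<le> \<mu>" and "\<mu> < 1"
    and "r = (LEAST j. real j > \<mu> * real k)"
    and "0 < \<gamma>" and "\<gamma> < 1" and "\<gamma> * real n \<in> \<nat>"
  shows "efficiency \<gamma> (poly_nodes k q) (poly_design k q d) k \<mu>
           \<ge> ereal (\<gamma> powi (1 - int d) * real (r choose d) / real (k choose d) - 1)"
proof (cases "max_corrupted \<gamma> (poly_nodes k q) (poly_design k q d) k \<mu> = 0")
  case True
  then show ?thesis
    by (simp add: efficiency_def)
next
  case False
  let ?S = "poly_nodes k q"
  define f where "f = max_corrupted \<gamma> ?S (poly_design k q d) k \<mu>"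
  have finS: "finite ?S"
    by (simp add: poly_nodes_def)
  have cardS: "card ?S = n"
    using assms(6) by (simp add: card_poly_nodes)
  let ?M = "{card (corrupted_groups (poly_design k q d) k \<mu> B) |
      B. B \<subseteq> ?S \<and> real (card B) = \<gamma> * real (card ?S)}"
  \<comment> \<open>Since \<open>\<gamma> * n\<close> is a natural number at most \<open>n\<close>,
    a set of the required size exists; the maximum is therefore over a nonempty finite set and is
    attained by some \<open>B\<close>.\<close>
  obtain c where c: "\<gamma> * real n = real c"
    using assms(12) by (auto elim: Nats_cases)
  have "real c \<le> real n"
    using assms(11) mult_right_mono[of \<gamma> 1 "real n"] unfolding c[symmetric] by simp
  then obtain B0 where "B0 \<subseteq> ?S" "card B0 = c"
    using obtain_subset_with_card_n[of c ?S] cardS by auto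
  then have "?M \<noteq> {}"
    using c cardS by auto
  moreover have "?M \<subseteq> (\<lambda>B. card (corrupted_groups (poly_design k q d) k \<mu> B)) ` Pow ?S"
    by auto
  then have "finite ?M"
    by (rule finite_subset) (simp add: finS)
  ultimately have "f \<in> ?M"
    unfolding f_def max_corrupted_def by (intro Max_in)
  then obtain B where B: "B \<subseteq> ?S" "real (card B) = \<gamma> * real n"
    "f = card (corrupted_groups (poly_design k q d) k \<mu> B)"
    using cardS by auto
  have "real (card B) / real k = \<gamma> * real q"
    using assms(1,6) B(2) by simp
  then have bound: "real f * real (r choose d) \<le> real (k choose d) * (\<gamma> * real q) ^ d"
    using card_corrupted_le[OF assms(2,3) B(1) assms(9), of d] B(3) by simp
  have pos: "0 < real f" "0 < real (k choose d)" "0 < \<gamma> ^ d"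
    using False assms(5,10) by (auto simp: f_def)
  have "\<gamma> powi (1 - int d) = \<gamma> / \<gamma> ^ d"
    using assms(10) by (simp add: power_int_diff)
  \<comment> \<open>Expanding the fraction by \<open>f\<close>, nonzero in this case, produces the
    left-hand side of \<open>bound\<close>.\<close>
  then have "\<gamma> powi (1 - int d) * real (r choose d) / real (k choose d)
      = \<gamma> * (real f * real (r choose d)) / (\<gamma> ^ d * real (k choose d) * real f)"
    using pos by simp
  also have "\<dots> \<le> \<gamma> * (real (k choose d) * (\<gamma> * real q) ^ d) / (\<gamma> ^ d * real (k choose d) * real f)"
    using bound assms(10) by (intro divide_right_mono mult_left_mono) auto
  also have "\<dots> = \<gamma> * real (q ^ d) / real f"
    using pos by (simp add: power_mult_distrib)
  also have "q ^ d = card (poly_design k q d)"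
    using card_poly_design[OF assms(2,3), of d] assms(5) by simp
  finally show ?thesis
    using False by (simp add: efficiency_def f_def)
qed

end
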